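(* The difference between $c_{mon}(M)$ and $c(M)$ can be arbitrarily large for monoids of the form $M=\langle a,a+1,\mathcal F\langle a,a+1\rangle\rangle$; that is, for every $N\in\mathbb N$ there is an integer $a\ge 4$ such that $M=\langle a,a+1,\mathcal F\langle a,a+1\rangle\rangle$ satisfies $c_{mon}(M)-c(M)\ge N$.
   Context: $\mathbb N$ includes $0$. A numerical monoid is a cofinite additive submonoid of $\mathbb N$, written $M=\langle n_1,\ldots,n_k\rangle$ with $n_1,\ldots,n_k$ its minimal generators. $\mathcal F\langle a,a+1\rangle$ denotes the Frobenius number of $\langle a,a+1\rangle$, the largest integer not in $\langle a,a+1\rangle$, which equals $a^2-a-1$. For $m\in M=\langle n_1,n_2,n_3\rangle$: $\mathcal Z(m)=\{(z_1,z_2,z_3)\in\mathbb N^3 : z_1n_1+z_2n_2+z_3n_3=m\}$ (factorizations); the length is $|z|=z_1+z_2+z_3$. For $z,z'\in\mathcal Z(m)$, $\gcd\{z,z'\}$ is the coordinatewise minimum and $d(z,z')=\max\{|z|,|z'|\}-|\gcd\{z,z'\}|$. An $N$-chain from $z$ to $z'$ is a finite sequence of factorizations of $m$ starting at $z$ and ending at $z'$ with consecutive distances $\le N$. $c(m)$ is the smallest $N\in\mathbb N$ such that any two factorizations of $m$ are connected by an $N$-chain. $c_{mon}(m)$ is the smallest $N\in\mathbb N$ such that any two factorizations of $m$ are connected by an $N$-chain along which the lengths are either non-decreasing throughout or non-increasing throughout. $c(M)=\max\{c(m):m\in M\}$ and $c_{mon}(M)=\max\{c_{mon}(m):m\in M\}$.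 *)

theory Defs
  imports Main "HOL.Hull"
begin

definition additive_submonoid :: "nat set \<Rightarrow> bool" where
  "additive_submonoid M \<longleftrightarrow> 0 \<in> M \<and> (\<forall>x\<in>M. \<forall>y\<in>M. x + y \<in> M)"

definition numerical_monoid :: "nat set \<Rightarrow> bool" where
  "numerical_monoid M \<longleftrightarrow> additive_submonoid M \<and> finite (- M)"

definition monoid_gen :: "nat set \<Rightarrow> nat set" where
  "monoid_gen S = additive_submonoid hull S"

definition minimal_generators :: "nat set \<Rightarrow> nat set \<Rightarrow> bool" where
  "minimal_generators M S \<longleftrightarrow> monoid_gen S = M \<and> (\<forall>T. T \<subset> S \<longrightarrow> monoid_gen T \<noteq> M)"

(* The greatest element is taken over the integers, so the value is also the intended one
   (namely -1) when M is all of nat. *)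
definition frobenius_number :: "nat set \<Rightarrow> int" where
  "frobenius_number M = (GREATEST n. n \<notin> int ` M)"

type_synonym fact3 = "nat \<times> nat \<times> nat"

fun flen :: "fact3 \<Rightarrow> nat" where
  "flen (z1, z2, z3) = z1 + z2 + z3"

fun fgcd :: "fact3 \<Rightarrow> fact3 \<Rightarrow> fact3" where
  "fgcd (z1, z2, z3) (w1, w2, w3) = (min z1 w1, min z2 w2, min z3 w3)"

(* The subtraction never truncates, since flen (fgcd z w) is at most flen z and flen w. *)
definition fdist :: "fact3 \<Rightarrow> fact3 \<Rightarrow> nat" where
  "fdist z w = max (flen z) (flen w) - flen (fgcd z w)"

definition factorizations :: "nat \<Rightarrow> nat \<Rightarrow> nat \<Rightarrow> nat \<Rightarrow> fact3 set" where
  "factorizations n1 n2 n3 m = {(z1, z2, z3). z1 * n1 + z2 * n2 + z3 * n3 = m}"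

definition is_chain :: "fact3 set \<Rightarrow> nat \<Rightarrow> fact3 \<Rightarrow> fact3 \<Rightarrow> fact3 list \<Rightarrow> bool" where
  "is_chain Z N z w zs \<longleftrightarrow>
     zs \<noteq> [] \<and> hd zs = z \<and> last zs = w \<and> set zs \<subseteq> Z \<and>
     successively (\<lambda>x y. fdist x y \<le> N) zs"

definition is_mon_chain :: "fact3 set \<Rightarrow> nat \<Rightarrow> fact3 \<Rightarrow> fact3 \<Rightarrow> fact3 list \<Rightarrow> bool" where
  "is_mon_chain Z N z w zs \<longleftrightarrow>
     is_chain Z N z w zs \<and>
     (sorted_wrt (\<le>) (map flen zs) \<or> sorted_wrt (\<ge>) (map flen zs))"

definition catenary_degree_elem :: "nat \<Rightarrow> nat \<Rightarrow> nat \<Rightarrow> nat \<Rightarrow> nat" where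
  "catenary_degree_elem n1 n2 n3 m =
     (LEAST N. \<forall>z\<in>factorizations n1 n2 n3 m. \<forall>w\<in>factorizations n1 n2 n3 m.
        \<exists>zs. is_chain (factorizations n1 n2 n3 m) N z w zs)"

definition mon_catenary_degree_elem :: "nat \<Rightarrow> nat \<Rightarrow> nat \<Rightarrow> nat \<Rightarrow> nat" where
  "mon_catenary_degree_elem n1 n2 n3 m =
     (LEAST N. \<forall>z\<in>factorizations n1 n2 n3 m. \<forall>w\<in>factorizations n1 n2 n3 m.
        \<exists>zs. is_mon_chain (factorizations n1 n2 n3 m) N z w zs)"

(* Invariants of the monoid generated by n1, n2, n3, to be used only when these are its
   minimal generators. Both maxima are over infinite families, but over finite sets of values
   whenever the generators are positive. *)
definition catenary_degree :: "nat \<Rightarrow> nat \<Rightarrow> nat \<Rightarrow> nat" where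
  "catenary_degree n1 n2 n3 =
     Max {catenary_degree_elem n1 n2 n3 m | m. m \<in> monoid_gen {n1, n2, n3}}"

definition mon_catenary_degree :: "nat \<Rightarrow> nat \<Rightarrow> nat \<Rightarrow> nat" where
  "mon_catenary_degree n1 n2 n3 =
     Max {mon_catenary_degree_elem n1 n2 n3 m | m. m \<in> monoid_gen {n1, n2, n3}}"

end

theory Submission
  imports Defs Complex_Main "HOL-Library.Product_Plus"
begin

text \<open>
  Fix \<open>a \<ge> 4\<close>, let \<open>f = a\<^sup>2 - a - 1\<close> be the Frobenius number of \<open>\<langle>a, a + 1\<rangle>\<close>, and put
  \<open>L = f - a\<close>. The two catenary degrees grow at different rates: \<open>c(M)\<close> is at most linear in
  \<open>a\<close>, whereas \<open>c\<^sub>m\<^sub>o\<^sub>n(M)\<close> is at least quadratic.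

  For \<open>c(M) \<le> 2 a - 3\<close>, the relations
  \<open>a + 1 + f = a \<cdot> a\<close>, \<open>a + f = (a - 1)(a + 1)\<close>, \<open>2 f = (a - 1) a + (a - 2)(a + 1)\<close> and
  \<open>(a + 1) a = a (a + 1)\<close>
  give exchanges between factorizations at distance at most \<open>2 a - 3\<close>. Used from left to right,
  they bring every factorization into a normal form that depends only on the element factored
  (\<open>reducible_step\<close>, \<open>normal_form_unique\<close>).

  For \<open>c\<^sub>m\<^sub>o\<^sub>n(M) \<ge> L\<close>, a monotone chain between two factorizations of equal length passes only
  through factorizations of that length. The element \<open>L (a + 1)\<close> has exactly two factorizations
  of length \<open>L\<close>, namely \<open>(0, L, 0)\<close> and \<open>(L - 1, 0, 1)\<close>; they have no generator in common, so
  one step of size \<open>L\<close> is unavoidable (\<open>equal_length_factorizations\<close>).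

  A maximum over all elements of \<open>M\<close> is meaningful only when the values are bounded. For
  \<open>c\<^sub>m\<^sub>o\<^sub>n\<close> the bound comes from Dickson's lemma: the pairs \<open>(z, w)\<close> of factorizations of a common
  element with \<open>|z| \<le> |w|\<close> form a monoid with finitely many atoms, and splitting a pair into atoms
  gives a monotone chain that exchanges one atom at a time (\<open>mon_steps_bounded\<close>).

  The difference is therefore at least \<open>a\<^sup>2 - 4 a + 2\<close>, which exceeds \<open>N\<close> for \<open>a = N + 4\<close>.
\<close>

section \<open>Finitely generated monoids of natural numbers\<close>

lemma additive_submonoid_monoid_gen: "additive_submonoid (monoid_gen S)"
  unfolding monoid_gen_def by (rule hull_in) (auto simp: additive_submonoid_def)

lemma monoid_gen_mono: "S \<subseteq> T \<Longrightarrow> monoid_gen S \<subseteq> monoid_gen T"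
  unfolding monoid_gen_def by (rule hull_mono)

lemma generators_subset_monoid_gen: "S \<subseteq> monoid_gen S"
  unfolding monoid_gen_def by (rule hull_subset)

lemma multiple_in_submonoid:
  assumes "additive_submonoid M" "x \<in> M"
  shows "k * x \<in> M"
  using assms by (induction k) (auto simp: additive_submonoid_def)

lemma monoid_gen_empty: "monoid_gen {} = {0}"
  unfolding monoid_gen_def by (rule hull_unique) (auto simp: additive_submonoid_def)

lemma monoid_gen_insert: "monoid_gen (insert x S) = {k * x + s | k s. s \<in> monoid_gen S}"
proof -
  have S: "additive_submonoid (monoid_gen S)" by (rule additive_submonoid_monoid_gen)
  have closed: "additive_submonoid {k * x + s | k s. s \<in> monoid_gen S}"
    unfolding additive_submonoid_def
  proof (intro conjI ballI)
    show "0 \<in> {k * x + s | k s. s \<in> monoid_gen S}"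
      using S by (auto simp: additive_submonoid_def)
  next
    fix u v assume "u \<in> {k * x + s | k s. s \<in> monoid_gen S}" "v \<in> {k * x + s | k s. s \<in> monoid_gen S}"
    then obtain k s l t where "u = k * x + s" "v = l * x + t" "s \<in> monoid_gen S" "t \<in> monoid_gen S"
      by blast
    moreover from this have "s + t \<in> monoid_gen S" using S by (auto simp: additive_submonoid_def)
    moreover have "k * x + s + (l * x + t) = (k + l) * x + (s + t)" by (simp add: algebra_simps)
    ultimately show "u + v \<in> {k * x + s | k s. s \<in> monoid_gen S}" by blast
  qed
  show ?thesis
    unfolding monoid_gen_def[of "insert x S"]
  proof (rule hull_unique)
    have "0 \<in> monoid_gen S" using S by (auto simp: additive_submonoid_def)
    then have "x \<in> {k * x + s | k s. s \<in> monoid_gen S}" by (auto intro: exI[of _ 1])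
    moreover have "S \<subseteq> {k * x + s | k s. s \<in> monoid_gen S}"
      using generators_subset_monoid_gen[of S] by (fastforce intro: exI[of _ "0::nat"])
    ultimately show "insert x S \<subseteq> {k * x + s | k s. s \<in> monoid_gen S}" by blast
  next
    show "additive_submonoid {k * x + s | k s. s \<in> monoid_gen S}" by (rule closed)
  next
    fix T assume T: "insert x S \<subseteq> T" "additive_submonoid T"
    then have "monoid_gen S \<subseteq> T" unfolding monoid_gen_def by (intro hull_minimal) auto
    moreover have "k * x \<in> T" for k using T multiple_in_submonoid by auto
    ultimately show "{k * x + s | k s. s \<in> monoid_gen S} \<subseteq> T"
      using T(2) by (auto simp: additive_submonoid_def)
  qed
qed

lemma monoid_gen_two: "monoid_gen {x, y} = {i * x + j * y | i j. True}"
  by (auto simp: monoid_gen_insert monoid_gen_empty)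

lemma minimal_generatorsI:
  assumes "\<And>s. s \<in> S \<Longrightarrow> s \<notin> monoid_gen (S - {s})"
  shows "minimal_generators (monoid_gen S) S"
  unfolding minimal_generators_def
proof (intro conjI allI impI)
  fix T assume "T \<subset> S"
  then obtain s where s: "s \<in> S" "T \<subseteq> S - {s}" by blast
  then have "s \<notin> monoid_gen T" using assms monoid_gen_mono by blast
  moreover have "s \<in> monoid_gen S" using s generators_subset_monoid_gen by blast
  ultimately show "monoid_gen T \<noteq> monoid_gen S" by blast
qed simp

section \<open>Factorizations and exchanges\<close>

fun fval :: "nat \<Rightarrow> nat \<Rightarrow> nat \<Rightarrow> fact3 \<Rightarrow> nat" where
  "fval n1 n2 n3 (z1, z2, z3) = z1 * n1 + z2 * n2 + z3 * n3"

lemma factorizations_iff: "z \<in> factorizations n1 n2 n3 m \<longleftrightarrow> fval n1 n2 n3 z = m"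
  by (cases z) (auto simp: factorizations_def)

lemma fval_add: "fval n1 n2 n3 (z + w) = fval n1 n2 n3 z + fval n1 n2 n3 w"
  by (cases z; cases w) (auto simp: algebra_simps)

lemma flen_add: "flen (z + w) = flen z + flen w"
  by (cases z; cases w) auto

lemma flen_eq_0_iff: "flen z = 0 \<longleftrightarrow> z = 0"
  by (cases z) (auto simp: zero_prod_def)

lemma fdist_commute: "fdist z w = fdist w z"
  by (cases z; cases w) (auto simp: fdist_def min.commute max.commute)

lemma fdist_add_right: "fdist (z + c) (w + c) = fdist z w"
proof -
  have "fgcd (z + c) (w + c) = fgcd z w + c"
    by (cases z; cases w; cases c) auto
  then show ?thesis by (simp add: fdist_def flen_add)
qed

lemma fdist_le_max: "fdist z w \<le> max (flen z) (flen w)"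
  by (simp add: fdist_def)

definition exchange :: "nat \<Rightarrow> nat \<Rightarrow> nat \<Rightarrow> nat \<Rightarrow> fact3 \<Rightarrow> fact3 \<Rightarrow> bool" where
  "exchange n1 n2 n3 N z w \<longleftrightarrow> fval n1 n2 n3 z = fval n1 n2 n3 w \<and> fdist z w \<le> N"

definition mon_exchange :: "nat \<Rightarrow> nat \<Rightarrow> nat \<Rightarrow> nat \<Rightarrow> fact3 \<Rightarrow> fact3 \<Rightarrow> bool" where
  "mon_exchange n1 n2 n3 N z w \<longleftrightarrow> exchange n1 n2 n3 N z w \<and> flen z \<le> flen w"

lemma exchange_sym: "exchange n1 n2 n3 N z w \<Longrightarrow> exchange n1 n2 n3 N w z"
  by (simp add: exchange_def fdist_commute)

lemma exchange_add_right: "exchange n1 n2 n3 N z w \<Longrightarrow> exchange n1 n2 n3 N (z + c) (w + c)"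
  by (simp add: exchange_def fdist_add_right fval_add)

lemma mon_exchanges_add_right:
  "(mon_exchange n1 n2 n3 N)\<^sup>*\<^sup>* z w \<Longrightarrow> (mon_exchange n1 n2 n3 N)\<^sup>*\<^sup>* (z + c) (w + c)"
proof (induction rule: rtranclp_induct)
  case (step y w)
  have "mon_exchange n1 n2 n3 N (y + c) (w + c)"
    using step(2) by (simp add: mon_exchange_def exchange_add_right flen_add)
  with step.IH show ?case by (rule rtranclp.rtrancl_into_rtrancl)
qed simp

text \<open>
  Reachability is more convenient than explicit lists for composing chains; this lemma goes
  back to lists. The relation \<open>R\<close> is a parameter so that the list may carry the monotonicity of the
  lengths along with it.
\<close>
lemma chain_if_reachable:
  assumes "R\<^sup>*\<^sup>* z w" "fval n1 n2 n3 z = m" "\<And>x y. R x y \<Longrightarrow> exchange n1 n2 n3 N x y"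
  shows "\<exists>zs. is_chain (factorizations n1 n2 n3 m) N z w zs \<and> successively R zs"
  using assms(1)
proof (induction rule: rtranclp_induct)
  case base
  show ?case using assms(2) by (intro exI[of _ "[z]"]) (auto simp: is_chain_def factorizations_iff)
next
  case (step y w)
  then obtain zs where zs: "is_chain (factorizations n1 n2 n3 m) N z y zs" "successively R zs"
    by blast
  have ex: "exchange n1 n2 n3 N y w" using step(2) assms(3) by blast
  have "y \<in> factorizations n1 n2 n3 m" using zs(1) by (auto simp: is_chain_def)
  then have "w \<in> factorizations n1 n2 n3 m" using ex by (simp add: factorizations_iff exchange_def)
  then have "is_chain (factorizations n1 n2 n3 m) N z w (zs @ [w])"
    using zs ex by (auto simp: is_chain_def successively_append_iff exchange_def)
  moreover have "successively R (zs @ [w])"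
    using zs step(2) by (auto simp: is_chain_def successively_append_iff)
  ultimately show ?case by blast
qed

lemma mon_chain_if_reachable:
  assumes "(mon_exchange n1 n2 n3 N)\<^sup>*\<^sup>* z w" "fval n1 n2 n3 z = m"
  shows "\<exists>zs. is_mon_chain (factorizations n1 n2 n3 m) N z w zs"
proof -
  obtain zs where zs: "is_chain (factorizations n1 n2 n3 m) N z w zs"
      "successively (mon_exchange n1 n2 n3 N) zs"
    using chain_if_reachable[OF assms] by (auto simp: mon_exchange_def)
  from zs(2) have "successively (\<lambda>x y. flen x \<le> flen y) zs"
    by (rule successively_mono) (auto simp: mon_exchange_def)
  then have "sorted (map flen zs)"
    by (subst sorted_wrt_map, subst successively_conv_sorted_wrt[symmetric]) (auto intro: transpI)
  with zs(1) show ?thesis by (auto simp: is_mon_chain_def)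
qed

lemma is_mon_chain_rev:
  assumes "is_mon_chain Z N z w zs"
  shows "is_mon_chain Z N w z (rev zs)"
proof -
  have "sorted_wrt (\<lambda>x y. y \<le> x) (map flen (rev zs)) \<longleftrightarrow> sorted_wrt (\<le>) (map flen zs)"
    "sorted_wrt (\<le>) (map flen (rev zs)) \<longleftrightarrow> sorted_wrt (\<lambda>x y. y \<le> x) (map flen zs)"
    by (simp_all only: rev_map[symmetric] sorted_wrt_rev)
  with assms show ?thesis
    by (auto simp: is_mon_chain_def is_chain_def hd_rev last_rev fdist_commute)
qed

section \<open>Monotone catenary degrees are bounded\<close>

text \<open>
  Each of the finitely many coordinates is dealt with in turn: a sequence of naturals has a monotone
  subsequence, and if that is decreasing it becomes constant.
\<close>
lemma common_mono_subseq:
  fixes s :: "nat \<Rightarrow> 'x" and G :: "('x \<Rightarrow> nat) set"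
  assumes "finite G"
  shows "\<exists>r :: nat \<Rightarrow> nat. strict_mono r \<and> (\<forall>g\<in>G. mono (\<lambda>n. g (s (r n))))"
  using assms
proof (induction rule: finite_induct)
  case empty
  show ?case by (auto intro: exI[of _ id] simp: strict_mono_def)
next
  case (insert g G)
  then obtain r :: "nat \<Rightarrow> nat" where r: "strict_mono r" "\<forall>h\<in>G. mono (\<lambda>n. h (s (r n)))" by blast
  obtain q :: "nat \<Rightarrow> nat" where q: "strict_mono q" "mono (\<lambda>n. g (s (r (q n))))"
  proof -
    let ?u = "\<lambda>n. g (s (r n))"
    obtain p :: "nat \<Rightarrow> nat" where p: "strict_mono p" "monoseq (\<lambda>n. ?u (p n))"
      using seq_monosub[of ?u] by auto
    show thesis
    proof (cases "mono (\<lambda>n. ?u (p n))")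
      case True
      then show thesis using that p by blast
    next
      case False
      then have dec: "?u (p n) \<le> ?u (p m)" if "m \<le> n" for m n
        using p(2) that by (auto simp: monoseq_def mono_def)
      obtain k where k: "\<forall>n. ?u (p k) \<le> ?u (p n)"
        using ex_has_least_nat[of "\<lambda>_. True" 0 "\<lambda>n. ?u (p n)"] by blast
      then have "?u (p (k + n)) = ?u (p k)" for n using dec[of k "k + n"] by (simp add: antisym)
      moreover have "strict_mono (\<lambda>n. p (k + n))" using p(1) by (simp add: strict_mono_def)
      ultimately show thesis using that[of "\<lambda>n. p (k + n)"] by (simp add: mono_def)
    qed
  qed
  have "mono (\<lambda>n. h (s (r (q n))))" if "h \<in> G" for h
    using r(2) that q(1) by (fastforce simp: mono_def strict_mono_less_eq)
  moreover have "strict_mono (r \<circ> q)" using r(1) q(1) by (rule strict_mono_o)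
  ultimately show ?case using q(2) by (intro exI[of _ "r \<circ> q"]) (simp add: comp_def)
qed

text \<open>Dickson's lemma, with the coordinates given as a finite set of functions.\<close>
lemma dickson:
  fixes G :: "('x \<Rightarrow> nat) set"
  assumes "finite G" "infinite A"
  shows "\<exists>x\<in>A. \<exists>y\<in>A. x \<noteq> y \<and> (\<forall>g\<in>G. g x \<le> g y)"
proof -
  obtain s :: "nat \<Rightarrow> 'x" where s: "inj s" "range s \<subseteq> A"
    using infinite_countable_subset[OF assms(2)] by blast
  obtain r :: "nat \<Rightarrow> nat" where r: "strict_mono r" "\<forall>g\<in>G. mono (\<lambda>n. g (s (r n)))"
    using common_mono_subseq[OF assms(1)] by blast
  have "s (r 0) \<noteq> s (r 1)"
    using s(1) r(1) by (auto simp: inj_eq strict_mono_eq)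
  moreover have "\<forall>g\<in>G. g (s (r 0)) \<le> g (s (r 1))" using r(2) by (auto simp: mono_def)
  ultimately show ?thesis using s(2) by blast
qed

definition mon_pairs :: "nat \<Rightarrow> nat \<Rightarrow> nat \<Rightarrow> (fact3 \<times> fact3) set" where
  "mon_pairs n1 n2 n3 = {(z, w). fval n1 n2 n3 z = fval n1 n2 n3 w \<and> flen z \<le> flen w}"

text \<open>
  The excess \<open>flen w - flen z\<close> counts as a seventh coordinate. This makes the difference of two
  comparable elements of \<^const>\<open>mon_pairs\<close> again an element of \<^const>\<open>mon_pairs\<close>.
\<close>
fun pair_le :: "fact3 \<times> fact3 \<Rightarrow> fact3 \<times> fact3 \<Rightarrow> bool" where
  "pair_le ((x1, x2, x3), (y1, y2, y3)) ((z1, z2, z3), (w1, w2, w3)) \<longleftrightarrow>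
     x1 \<le> z1 \<and> x2 \<le> z2 \<and> x3 \<le> z3 \<and> y1 \<le> w1 \<and> y2 \<le> w2 \<and> y3 \<le> w3 \<and>
     flen (y1, y2, y3) - flen (x1, x2, x3) \<le> flen (w1, w2, w3) - flen (z1, z2, z3)"

definition pair_atoms :: "nat \<Rightarrow> nat \<Rightarrow> nat \<Rightarrow> (fact3 \<times> fact3) set" where
  "pair_atoms n1 n2 n3 =
     {p \<in> mon_pairs n1 n2 n3. p \<noteq> 0 \<and> (\<forall>q\<in>mon_pairs n1 n2 n3. q \<noteq> 0 \<and> pair_le q p \<longrightarrow> q = p)}"

lemma finite_pair_atoms: "finite (pair_atoms n1 n2 n3)"
proof (rule ccontr)
  let ?G = "{\<lambda>((x1, x2, x3), (y1, y2, y3)). x1, \<lambda>((x1, x2, x3), (y1, y2, y3)). x2,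
     \<lambda>((x1, x2, x3), (y1, y2, y3)). x3, \<lambda>((x1, x2, x3), (y1, y2, y3)). y1,
     \<lambda>((x1, x2, x3), (y1, y2, y3)). y2, \<lambda>((x1, x2, x3), (y1, y2, y3)). y3,
     \<lambda>(x, y). flen y - flen x} :: (fact3 \<times> fact3 \<Rightarrow> nat) set"
  assume "infinite (pair_atoms n1 n2 n3)"
  then obtain p q where pq: "p \<in> pair_atoms n1 n2 n3" "q \<in> pair_atoms n1 n2 n3" "p \<noteq> q"
      "\<forall>g\<in>?G. g p \<le> g q"
    using dickson[of ?G] by blast
  obtain x1 x2 x3 y1 y2 y3 z1 z2 z3 w1 w2 w3 where
    "p = ((x1, x2, x3), (y1, y2, y3))" "q = ((z1, z2, z3), (w1, w2, w3))"
    by (metis prod.exhaust)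
  with pq(4) have "pair_le p q" by simp
  with pq show False by (auto simp: pair_atoms_def)
qed

lemma mon_pairs_split:
  assumes "p \<in> mon_pairs n1 n2 n3" "q \<in> mon_pairs n1 n2 n3" "pair_le q p"
  obtains r where "r \<in> mon_pairs n1 n2 n3" "p = q + r"
proof -
  obtain z w u v where p: "p = (z, w)" and q: "q = (u, v)" by (cases p; cases q) blast
  obtain u' v' where z: "z = u + u'" and w: "w = v + v'"
  proof -
    have "z = u + (z - u)" "w = v + (w - v)"
      using assms(3) unfolding p q by (cases z; cases w; cases u; cases v; simp)+
    then show thesis using that by blast
  qed
  have "flen v - flen u \<le> flen w - flen z"
    using assms(3) unfolding p q by (cases z; cases w; cases u; cases v; simp)
  then have "(u', v') \<in> mon_pairs n1 n2 n3"
    using assms(1,2) unfolding p q z w by (auto simp: mon_pairs_def fval_add flen_add)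
  then show thesis using that[of "(u', v')"] by (simp add: p q z w)
qed

text \<open>
  An atom \<open>(u, v)\<close> is a single exchange of size at most \<open>|v|\<close>. A pair that is not an atom is a sum of
  two smaller pairs, and the chains for these, each translated by an endpoint of the other, are
  joined.
\<close>
lemma mon_steps_bounded:
  "\<exists>N. \<forall>z w. (z, w) \<in> mon_pairs n1 n2 n3 \<longrightarrow> (mon_exchange n1 n2 n3 N)\<^sup>*\<^sup>* z w"
proof -
  obtain N where N: "\<And>u v. (u, v) \<in> pair_atoms n1 n2 n3 \<Longrightarrow> flen v \<le> N"
  proof -
    have "finite ((\<lambda>(u, v). flen v) ` pair_atoms n1 n2 n3)" using finite_pair_atoms by blast
    then obtain N where "\<forall>k \<in> (\<lambda>(u, v). flen v) ` pair_atoms n1 n2 n3. k \<le> N"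
      using finite_nat_set_iff_bounded_le by blast
    then show thesis using that[of N] by fastforce
  qed
  have "(mon_exchange n1 n2 n3 N)\<^sup>*\<^sup>* z w" if "(z, w) \<in> mon_pairs n1 n2 n3" for z w
    using that
  proof (induction "flen z + flen w" arbitrary: z w rule: less_induct)
    case less
    consider "(z, w) \<in> pair_atoms n1 n2 n3" | "(z, w) = 0"
      | q where "q \<in> mon_pairs n1 n2 n3" "q \<noteq> 0" "pair_le q (z, w)" "q \<noteq> (z, w)"
      using less.prems unfolding pair_atoms_def by blast
    then show ?case
    proof cases
      case 1
      then have "mon_exchange n1 n2 n3 N z w"
        using less.prems N[OF 1] fdist_le_max[of z w]
        by (auto simp: mon_exchange_def exchange_def mon_pairs_def)
      then show ?thesis by blast
    next
      case 2
      then show ?thesis by (simp add: zero_prod_def)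
    next
      case (3 q)
      then obtain r where r: "r \<in> mon_pairs n1 n2 n3" "(z, w) = q + r"
        using less.prems by (auto elim: mon_pairs_split)
      obtain u v u' v' where q: "q = (u, v)" and r': "r = (u', v')"
        by (cases q; cases r) blast
      have z: "z = u + u'" and w: "w = v + v'" using r(2) by (auto simp: q r')
      have "r \<noteq> 0" using 3 r(2) by auto
      then have "\<not> (flen u' = 0 \<and> flen v' = 0)" by (simp add: r' zero_prod_def flen_eq_0_iff)
      then have 1: "(mon_exchange n1 n2 n3 N)\<^sup>*\<^sup>* u v"
        using less.hyps[of u v] 3(1) by (simp add: z w q flen_add)
      have "\<not> (flen u = 0 \<and> flen v = 0)" using 3(2) by (simp add: q zero_prod_def flen_eq_0_iff)
      then have 2: "(mon_exchange n1 n2 n3 N)\<^sup>*\<^sup>* u' v'"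
        using less.hyps[of u' v'] r(1) by (simp add: z w r' flen_add)
      have "(mon_exchange n1 n2 n3 N)\<^sup>*\<^sup>* (u + u') (v + u')"
        using 1 by (rule mon_exchanges_add_right)
      also have "(mon_exchange n1 n2 n3 N)\<^sup>*\<^sup>* (v + u') (v + v')"
        using mon_exchanges_add_right[OF 2, of v] by (simp add: add.commute)
      finally show ?thesis by (simp add: z w)
    qed
  qed
  then show ?thesis by blast
qed

lemma mon_chains_bounded:
  "\<exists>N. \<forall>m. \<forall>z\<in>factorizations n1 n2 n3 m. \<forall>w\<in>factorizations n1 n2 n3 m.
     \<exists>zs. is_mon_chain (factorizations n1 n2 n3 m) N z w zs"
proof -
  obtain N where N: "\<And>z w. (z, w) \<in> mon_pairs n1 n2 n3 \<Longrightarrow> (mon_exchange n1 n2 n3 N)\<^sup>*\<^sup>* z w"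
    using mon_steps_bounded by blast
  have "\<exists>zs. is_mon_chain (factorizations n1 n2 n3 m) N z w zs"
    if "fval n1 n2 n3 z = m" "fval n1 n2 n3 w = m" for m z w
  proof (cases "flen z \<le> flen w")
    case True
    then show ?thesis using that N[of z w] by (intro mon_chain_if_reachable) (auto simp: mon_pairs_def)
  next
    case False
    then have "(mon_exchange n1 n2 n3 N)\<^sup>*\<^sup>* w z"
      using that by (intro N) (simp add: mon_pairs_def)
    then obtain zs where "is_mon_chain (factorizations n1 n2 n3 m) N w z zs"
      using mon_chain_if_reachable \<open>fval n1 n2 n3 w = m\<close> by blast
    then show ?thesis using is_mon_chain_rev by blast
  qed
  then show ?thesis by (intro exI[of _ N] allI ballI) (simp add: factorizations_iff)
qed

lemma mon_chain_mon_catenary_degree_elem: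
  assumes "z \<in> factorizations n1 n2 n3 m" "w \<in> factorizations n1 n2 n3 m"
  shows "\<exists>zs. is_mon_chain (factorizations n1 n2 n3 m) (mon_catenary_degree_elem n1 n2 n3 m) z w zs"
proof -
  let ?P = "\<lambda>N. \<forall>z\<in>factorizations n1 n2 n3 m. \<forall>w\<in>factorizations n1 n2 n3 m.
     \<exists>zs. is_mon_chain (factorizations n1 n2 n3 m) N z w zs"
  have "\<exists>N. ?P N" using mon_chains_bounded by blast
  then have "?P (mon_catenary_degree_elem n1 n2 n3 m)"
    unfolding mon_catenary_degree_elem_def by (rule LeastI_ex)
  then show ?thesis using assms by blast
qed

lemma mon_catenary_degree_elem_le:
  assumes "m \<in> monoid_gen {n1, n2, n3}"
  shows "mon_catenary_degree_elem n1 n2 n3 m \<le> mon_catenary_degree n1 n2 n3"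
proof -
  obtain N where N: "\<forall>m. \<forall>z\<in>factorizations n1 n2 n3 m. \<forall>w\<in>factorizations n1 n2 n3 m.
     \<exists>zs. is_mon_chain (factorizations n1 n2 n3 m) N z w zs"
    using mon_chains_bounded by blast
  have "mon_catenary_degree_elem n1 n2 n3 m \<le> N" for m
    unfolding mon_catenary_degree_elem_def by (rule Least_le) (rule N[THEN spec])
  then have "{mon_catenary_degree_elem n1 n2 n3 m | m. m \<in> monoid_gen {n1, n2, n3}} \<subseteq> {..N}"
    by auto
  then have "finite {mon_catenary_degree_elem n1 n2 n3 m | m. m \<in> monoid_gen {n1, n2, n3}}"
    by (rule finite_subset) simp
  then show ?thesis unfolding mon_catenary_degree_def by (rule Max_ge) (use assms in blast)
qed

section \<open>The generators $a$, $a+1$ and the Frobenius number\<close>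

lemma frobenius_not_combination:
  fixes f a i j :: nat
  assumes "f + a + 1 = a * a"
  shows "f \<noteq> i * a + j * (a + 1)"
proof
  \<comment> \<open>Modulo \<open>a\<close> the equation forces \<open>j \<equiv> -1\<close>, hence \<open>j \<ge> a - 1\<close>, and then the right-hand side is
    already too large.\<close>
  assume "f = i * a + j * (a + 1)"
  then have "a * a = i * a + j * (a + 1) + a + 1" using assms by simp
  also have "\<dots> = (i + j + 1) * a + (j + 1)" by (simp add: algebra_simps)
  finally have eq: "(i + j + 1) * a + (j + 1) = a * a" ..
  then have "a dvd (i + j + 1) * a + (j + 1)" by simp
  then have "a dvd j + 1" by (simp only: dvd_add_right_iff dvd_triv_right)
  then have "a \<le> j + 1" by (rule dvd_imp_le) simp
  then have "a * a \<le> (i + j + 1) * a" by (intro mult_le_mono1) simp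
  with eq show False by simp
qed

lemma combination_if_greater_frobenius:
  assumes "f + a + 1 = a * a" "n > f"
  shows "n \<in> monoid_gen {a, a + 1}"
proof -
  have "a > 0" using assms(1) by (cases a) auto
  have "n mod a \<le> n div a"
  proof (rule ccontr)
    assume "\<not> n mod a \<le> n div a"
    then have "n div a + 1 \<le> n mod a" by simp
    moreover have "n mod a < a" using \<open>a > 0\<close> by simp
    ultimately have "n div a + 2 \<le> a" by simp
    then have "(n div a + 2) * a \<le> a * a" by (rule mult_le_mono1)
    then have "n div a * a + 2 * a \<le> a * a" by (simp add: algebra_simps)
    moreover have "n = n div a * a + n mod a" by simp
    ultimately show False using assms \<open>n mod a < a\<close> by linarith
  qed
  \<comment> \<open>The remainder is spread over as many copies of \<open>a\<close>, turning them into \<open>a + 1\<close>.\<close>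
  then obtain k where k: "n div a = n mod a + k" using le_Suc_ex by blast
  have "n = (n mod a + k) * a + n mod a" using div_mult_mod_eq[of n a] k by simp
  then have "n = k * a + n mod a * (a + 1)" by (simp add: algebra_simps)
  then show ?thesis unfolding monoid_gen_two by blast
qed

lemma frobenius_number_consecutive:
  assumes "f + a + 1 = a * a"
  shows "frobenius_number (monoid_gen {a, a + 1}) = int f"
  unfolding frobenius_number_def
proof (rule Greatest_equality)
  show "int f \<notin> int ` monoid_gen {a, a + 1}"
    using frobenius_not_combination[OF assms] unfolding monoid_gen_two by (simp add: inj_image_mem_iff)
next
  fix y assume y: "y \<notin> int ` monoid_gen {a, a + 1}"
  show "y \<le> int f"
  proof (rule ccontr)
    assume "\<not> y \<le> int f"
    then have "nat y \<in> monoid_gen {a, a + 1}" "y = int (nat y)"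
      using combination_if_greater_frobenius[OF assms, of "nat y"] by auto
    with y show False by blast
  qed
qed

lemma numerical_monoid_frobenius:
  assumes "f + a + 1 = a * a"
  shows "numerical_monoid (monoid_gen {a, a + 1, f})"
proof -
  have "monoid_gen {a, a + 1} \<subseteq> monoid_gen {a, a + 1, f}" by (rule monoid_gen_mono) auto
  then have "- monoid_gen {a, a + 1, f} \<subseteq> {..f}"
    using combination_if_greater_frobenius[OF assms] by (force simp: not_le[symmetric])
  then show ?thesis
    unfolding numerical_monoid_def using additive_submonoid_monoid_gen finite_subset by blast
qed

lemma minimal_generators_frobenius:
  assumes f: "f + a + 1 = a * a" and a: "a \<ge> 4"
  shows "minimal_generators (monoid_gen {a, a + 1, f}) {a, a + 1, f}"
proof (rule minimal_generatorsI)
  have "4 * a \<le> a * a" using a by (rule mult_le_mono1)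
  with f a have fa: "f > a + 1" by linarith
  fix s assume "s \<in> {a, a + 1, f}"
  then consider "s = a" | "s = a + 1" | "s = f" by blast
  then show "s \<notin> monoid_gen ({a, a + 1, f} - {s})"
  proof cases
    case 1
    have "a \<noteq> i * (a + 1) + j * f" for i j
      using fa a by (cases i; cases j) auto
    moreover have "{a, a + 1, f} - {s} = {a + 1, f}" using fa 1 by auto
    ultimately show ?thesis using 1 by (auto simp: monoid_gen_two)
  next
    case 2
    have "a + 1 \<noteq> i * a + j * f" for i j
    proof
      assume *: "a + 1 = i * a + j * f"
      then have "j = 0" using fa by (cases j) auto
      with * have "a dvd a + 1" by simp
      then have "a dvd 1" by (simp only: dvd_add_right_iff dvd_refl)
      then show False using a by simp
    qed
    moreover have "{a, a + 1, f} - {s} = {a, f}" using fa 2 by auto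
    ultimately show ?thesis using 2 by (auto simp: monoid_gen_two)
  next
    case 3
    moreover have "{a, a + 1, f} - {s} = {a, a + 1}" using fa 3 by auto
    ultimately show ?thesis using frobenius_not_combination[OF f] by (auto simp: monoid_gen_two)
  qed
qed

section \<open>The catenary degree is at most $2a-3$\<close>

fun normal_form :: "nat \<Rightarrow> fact3 \<Rightarrow> bool" where
  "normal_form a (x, y, z) \<longleftrightarrow> z = 0 \<and> x \<le> a \<or> (x, y, z) = (0, 0, 1)"

text \<open>
  A factorization outside normal form contains the left-hand side of one of the four relations.
  The weights \<open>1\<close> and \<open>a + 1\<close> are chosen so that replacing \<open>(0, 1, 1)\<close> by \<open>(a, 0, 0)\<close> still
  decreases \<open>x + (a + 1) z\<close>. Replacing \<open>(0, 0, 2)\<close> spans the distance \<open>2 a - 3\<close>; the other three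
  span at most \<open>a + 1\<close>, which is no more because \<open>a \<ge> 4\<close>.
\<close>
lemma reducible_step:
  assumes f: "f + a + 1 = a * a" and a: "a \<ge> 4" and red: "\<not> normal_form a (x, y, z)"
  shows "\<exists>x' y' z'. exchange a (a + 1) f (2 * a - 3) (x, y, z) (x', y', z') \<and>
    x' + (a + 1) * z' < x + (a + 1) * z"
proof -
  obtain b where b: "a = b + 2" using a that[of "a - 2"] by simp
  then have fb: "f = b * b + 3 * b + 1" using f by (simp add: algebra_simps)
  have "b \<ge> 2" using a b by simp
  note [simp] = exchange_def fdist_def
  consider (yz) y1 z1 where "y = Suc y1" "z = Suc z1" | (xz) x1 z1 where "x = Suc x1" "z = Suc z1"
    | (zz) z1 where "z = Suc (Suc z1)" | (xx) x1 where "x = a + 1 + x1"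
    using red by (cases x; cases y; cases z; cases "z - 1") (auto simp: not_le less_iff_Suc_add)
  then show ?thesis
  proof cases
    case yz
    have "exchange a (a + 1) f (2 * a - 3) ((0, 1, 1) + (x, y1, z1)) ((a, 0, 0) + (x, y1, z1))"
      using \<open>b \<ge> 2\<close> by (intro exchange_add_right) (simp add: b fb algebra_simps)
    then show ?thesis using yz
      by - (rule exI[of _ "a + x"], rule exI[of _ y1], rule exI[of _ z1], simp del: exchange_def)
  next
    case xz
    have "exchange a (a + 1) f (2 * a - 3) ((1, 0, 1) + (x1, y, z1)) ((0, a - 1, 0) + (x1, y, z1))"
      using \<open>b \<ge> 2\<close> by (intro exchange_add_right) (simp add: b fb algebra_simps)
    then show ?thesis using xz
      by - (rule exI[of _ x1], rule exI[of _ "a - 1 + y"], rule exI[of _ z1], simp del: exchange_def)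
  next
    case zz
    have "exchange a (a + 1) f (2 * a - 3) ((0, 0, 2) + (x, y, z1)) ((a - 1, a - 2, 0) + (x, y, z1))"
      using \<open>b \<ge> 2\<close> by (intro exchange_add_right) (simp add: b fb algebra_simps)
    then show ?thesis using zz
      by - (rule exI[of _ "a - 1 + x"], rule exI[of _ "a - 2 + y"], rule exI[of _ z1], simp del: exchange_def)
  next
    case xx
    have "exchange a (a + 1) f (2 * a - 3) ((a + 1, 0, 0) + (x1, y, z)) ((0, a, 0) + (x1, y, z))"
      using \<open>b \<ge> 2\<close> by (intro exchange_add_right) (simp add: b fb algebra_simps)
    then show ?thesis using xx
      by - (rule exI[of _ x1], rule exI[of _ "a + y"], rule exI[of _ z], simp del: exchange_def)
  qed
qed

lemma reach_normal_form:
  assumes "f + a + 1 = a * a" "a \<ge> 4"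
  shows "\<exists>w. (exchange a (a + 1) f (2 * a - 3))\<^sup>*\<^sup>* (x, y, z) w \<and> normal_form a w"
proof (induction "x + (a + 1) * z" arbitrary: x y z rule: less_induct)
  case less
  show ?case
  proof (cases "normal_form a (x, y, z)")
    case True
    then show ?thesis by blast
  next
    case False
    then show ?thesis
      using reducible_step[OF assms False] less.hyps by (meson converse_rtranclp_into_rtranclp)
  qed
qed

lemma normal_form_unique:
  assumes f: "f + a + 1 = a * a"
    and nf: "normal_form a z" "normal_form a w" and eq: "fval a (a + 1) f z = fval a (a + 1) f w"
  shows "z = w"
proof -
  have coeff: "x = x'" if "x \<le> a" "x' \<le> a" and e: "x * a + y * (a + 1) = x' * a + y' * (a + 1)"
    for x y x' y'
  proof -
    \<comment> \<open>Since \<open>a \<equiv> -1\<close> modulo \<open>a + 1\<close>, the first coefficient is determined modulo \<open>a + 1\<close>.\<close>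
    have "(x' + (y + x) * (a + 1)) = (x + (y' + x') * (a + 1))" using e by (simp add: algebra_simps)
    then have "x' mod (a + 1) = x mod (a + 1)" by (metis mod_mult_self1)
    then show ?thesis using that by simp
  qed
  obtain x y c where z: "z = (x, y, c)" by (rule prod_cases3)
  obtain x' y' c' where w: "w = (x', y', c')" by (rule prod_cases3)
  show ?thesis
  proof (cases "c = 0 \<and> c' = 0")
    case True
    then have xy: "x * a + y * (a + 1) = x' * a + y' * (a + 1)" "x \<le> a" "x' \<le> a"
      using nf eq by (simp_all add: z w)
    then have x: "x = x'" by (intro coeff[of x x' y y'])
    with xy(1) have "y * (a + 1) = y' * (a + 1)" by simp
    then have "y = y'" by (simp only: mult_cancel2) simp
    with x True show ?thesis by (simp add: z w)
  next
    \<comment> \<open>Otherwise the element is \<open>f\<close>, which the first two generators alone cannot represent.\<close>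
    case False
    then have "z = (0, 0, 1) \<or> w = (0, 0, 1)" using nf by (auto simp: z w)
    moreover have "c' = 1" if "z = (0, 0, 1)"
      using that nf(2) eq frobenius_not_combination[OF f, of x' y'] by (cases "c' = 0") (simp_all add: w)
    moreover have "c = 1" if "w = (0, 0, 1)"
      using that nf(1) eq frobenius_not_combination[OF f, of x y] by (cases "c = 0") (simp_all add: z)
    ultimately show ?thesis using nf by (auto simp: z w)
  qed
qed

lemma fval_exchanges_eq:
  "(exchange n1 n2 n3 N)\<^sup>*\<^sup>* z w \<Longrightarrow> fval n1 n2 n3 z = fval n1 n2 n3 w"
  by (induction rule: rtranclp_induct) (auto simp: exchange_def)

lemma catenary_degree_elem_upper_bound:
  assumes "f + a + 1 = a * a" "a \<ge> 4"
  shows "catenary_degree_elem a (a + 1) f m \<le> 2 * a - 3"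
  unfolding catenary_degree_elem_def
proof (rule Least_le, intro ballI)
  let ?E = "exchange a (a + 1) f (2 * a - 3)"
  fix z w assume "z \<in> factorizations a (a + 1) f m" "w \<in> factorizations a (a + 1) f m"
  then have zw: "fval a (a + 1) f z = m" "fval a (a + 1) f w = m" by (simp_all add: factorizations_iff)
  obtain z' w' where z': "?E\<^sup>*\<^sup>* z z'" "normal_form a z'" and w': "?E\<^sup>*\<^sup>* w w'" "normal_form a w'"
    using reach_normal_form[OF assms] by (metis prod_cases3)
  have "z' = w'"
    using z'(2) w'(2) fval_exchanges_eq[OF z'(1)] fval_exchanges_eq[OF w'(1)] zw
    by (intro normal_form_unique[OF assms(1)]) simp_all
  moreover have "symp ?E" by (rule sympI) (rule exchange_sym)
  then have "?E\<^sup>*\<^sup>* w' w" using w'(1) by (meson symp_rtranclp sympD)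
  ultimately have "?E\<^sup>*\<^sup>* z w" using z'(1) by simp
  from chain_if_reachable[OF this zw(1)]
  show "\<exists>zs. is_chain (factorizations a (a + 1) f m) (2 * a - 3) z w zs" by blast
qed

lemma catenary_degree_upper_bound:
  assumes "f + a + 1 = a * a" "a \<ge> 4"
  shows "catenary_degree a (a + 1) f \<le> 2 * a - 3"
proof -
  let ?C = "{catenary_degree_elem a (a + 1) f m | m. m \<in> monoid_gen {a, a + 1, f}}"
  have bound: "?C \<subseteq> {..2 * a - 3}" using catenary_degree_elem_upper_bound[OF assms] by auto
  have "?C \<noteq> {}" using generators_subset_monoid_gen[of "{a, a + 1, f}"] by blast
  then show ?thesis
    unfolding catenary_degree_def using bound finite_subset[OF bound] by (subst Max_le_iff) auto
qed

section \<open>The monotone catenary degree is at least $a^2-2a-1$\<close>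

text \<open>
  Substituting \<open>f = a + L\<close>, the value of a factorization is \<open>a\<close> times its length plus
  \<open>z\<^sub>2 + L z\<^sub>3\<close>, so for a fixed length only this last quantity has to be matched.
\<close>
lemma equal_length_factorizations:
  assumes "L > 0" "fval a (a + 1) (a + L) z = L * (a + 1)" "flen z = L"
  shows "z = (0, L, 0) \<or> z = (L - 1, 0, 1)"
proof -
  obtain z1 z2 z3 where z: "z = (z1, z2, z3)" by (cases z) auto
  have len: "z1 + z2 + z3 = L" using assms(3) by (simp add: z)
  have "z1 * a + z2 * (a + 1) + z3 * (a + L) = (z1 + z2 + z3) * a + (z2 + L * z3)"
    by (simp add: algebra_simps)
  then have "(z1 + z2 + z3) * a + (z2 + L * z3) = L * a + L" using assms(2) by (simp add: z)
  then have e: "z2 + L * z3 = L" unfolding len by simp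
  then have "L * z3 \<le> L * 1" by linarith
  then have "z3 \<le> 1" using assms(1) by (simp only: nat_mult_le_cancel1)
  then consider "z3 = 0" | "z3 = 1" by linarith
  then show ?thesis
  proof cases
    case 1
    then show ?thesis using e len by (simp add: z)
  next
    case 2
    then show ?thesis using e len by (simp add: z)
  qed
qed

lemma mon_chain_equal_length:
  assumes "is_mon_chain Z N z w zs" "flen z = flen w" "x \<in> set zs"
  shows "flen x = flen z"
proof -
  have ne: "zs \<noteq> []" and ends: "hd zs = z" "last zs = w"
    using assms(1) by (auto simp: is_mon_chain_def is_chain_def)
  obtain i where i: "i < length zs" "x = zs ! i" using assms(3) by (auto simp: in_set_conv_nth)
  let ?n = "length zs - 1"
  have z: "z = zs ! 0" and w: "w = zs ! ?n" using ne ends by (auto simp: hd_conv_nth last_conv_nth)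
  have mono: "(\<forall>j k. j < k \<and> k < length zs \<longrightarrow> flen (zs ! j) \<le> flen (zs ! k)) \<or>
      (\<forall>j k. j < k \<and> k < length zs \<longrightarrow> flen (zs ! k) \<le> flen (zs ! j))"
    using assms(1) by (auto simp: is_mon_chain_def sorted_wrt_iff_nth_less)
  consider "i = 0" | "i = ?n" | "0 < i" "i < ?n" using i(1) by linarith
  then show ?thesis
  proof cases
    case 3
    have "?n < length zs" using ne by simp
    from mono have "flen (zs ! 0) \<le> flen x \<and> flen x \<le> flen (zs ! ?n) \<or>
        flen x \<le> flen (zs ! 0) \<and> flen (zs ! ?n) \<le> flen x"
      using 3 i \<open>?n < length zs\<close> by blast
    then show ?thesis using assms(2) unfolding z w by linarith
  qed (use z w i assms(2) in auto)
qed

lemma chain_stays: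
  assumes "successively P zs" "zs \<noteq> []" "hd zs = z" "\<And>x. x \<in> set zs \<Longrightarrow> P z x \<Longrightarrow> x = z"
  shows "last zs = z"
  using assms
proof (induction zs)
  case (Cons y ys)
  show ?case
  proof (cases ys)
    case Nil
    then show ?thesis using Cons.prems(3) by simp
  next
    case (Cons u us)
    then have "P z u" using Cons.prems(1,3) by simp
    then have "u = z" using Cons.prems(4) Cons by simp
    then have "last ys = z" using Cons.IH Cons.prems(1,4) Cons by simp
    then show ?thesis using Cons by simp
  qed
qed simp

lemma mon_catenary_degree_lower_bound:
  assumes "L > 0"
  shows "L \<le> mon_catenary_degree a (a + 1) (a + L)"
proof -
  let ?m = "L * (a + 1)"
  let ?Z = "factorizations a (a + 1) (a + L) ?m"
  let ?z = "(0, L, 0)" and ?w = "(L - 1, 0, 1)"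
  have "fval a (a + 1) (a + L) ?w = ?m" using assms by (cases L) (auto simp: algebra_simps)
  then have "?z \<in> ?Z" "?w \<in> ?Z" by (auto simp: factorizations_iff)
  then obtain zs where
    zs: "is_mon_chain ?Z (mon_catenary_degree_elem a (a + 1) (a + L) ?m) ?z ?w zs"
    using mon_chain_mon_catenary_degree_elem by blast
  have "L \<le> mon_catenary_degree_elem a (a + 1) (a + L) ?m" (is "_ \<le> ?N")
  proof (rule ccontr)
    assume "\<not> L \<le> ?N"
    have "x = ?z" if x: "x \<in> set zs" and d: "fdist ?z x \<le> ?N" for x
    proof -
      have "flen x = L" using mon_chain_equal_length[OF zs _ x] assms by simp
      moreover have "x \<in> ?Z" using zs x by (auto simp: is_mon_chain_def is_chain_def)
      ultimately have "x = ?z \<or> x = ?w"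
        using equal_length_factorizations[OF assms] by (simp add: factorizations_iff)
      moreover have "fdist ?z ?w = L" using assms by (simp add: fdist_def)
      ultimately show ?thesis using d \<open>\<not> L \<le> ?N\<close> by auto
    qed
    moreover have "successively (\<lambda>x y. fdist x y \<le> ?N) zs" "zs \<noteq> []" "hd zs = ?z" "last zs = ?w"
      using zs by (auto simp: is_mon_chain_def is_chain_def)
    ultimately have "last zs = ?z" by (intro chain_stays[of "\<lambda>x y. fdist x y \<le> ?N"])
    then show False using \<open>last zs = ?w\<close> by simp
  qed
  also have "\<dots> \<le> mon_catenary_degree a (a + 1) (a + L)"
  proof (rule mon_catenary_degree_elem_le)
    show "?m \<in> monoid_gen {a, a + 1, a + L}"
      using additive_submonoid_monoid_gen generators_subset_monoid_gen[of "{a, a + 1, a + L}"]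
      by (intro multiple_in_submonoid) auto
  qed
  finally show ?thesis .
qed

section \<open>The gap between the two degrees\<close>

theorem theorem12:
  "\<forall>N::nat. \<exists>a f :: nat. \<exists>M :: nat set.
     a \<ge> 4 \<and>
     int f = frobenius_number (monoid_gen {a, a + 1}) \<and>
     M = monoid_gen {a, a + 1, f} \<and>
     numerical_monoid M \<and>
     distinct [a, a + 1, f] \<and> minimal_generators M {a, a + 1, f} \<and>
     int (mon_catenary_degree a (a + 1) f) - int (catenary_degree a (a + 1) f) \<ge> int N"
proof
  fix N :: nat
  define a where "a = N + 4"
  \<comment> \<open>This is \<open>a\<^sup>2 - 2 a - 1\<close>, written without subtraction.\<close>
  define L where "L = N * N + 6 * N + 7"
  define f where "f = a + L"
  have a: "a \<ge> 4" by (simp add: a_def)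
  have f: "f + a + 1 = a * a" by (simp add: f_def L_def a_def algebra_simps)
  have "catenary_degree a (a + 1) f \<le> 2 * N + 5"
    using catenary_degree_upper_bound[OF f a] by (simp add: a_def)
  moreover have "L \<le> mon_catenary_degree a (a + 1) f"
    unfolding f_def by (rule mon_catenary_degree_lower_bound) (simp add: L_def)
  moreover have "2 * N + 5 + N \<le> L" by (simp add: L_def)
  ultimately have "int (mon_catenary_degree a (a + 1) f) - int (catenary_degree a (a + 1) f) \<ge> int N"
    by linarith
  moreover have "distinct [a, a + 1, f]" by (simp add: f_def L_def)
  ultimately show "\<exists>a f :: nat. \<exists>M :: nat set.
     a \<ge> 4 \<and>
     int f = frobenius_number (monoid_gen {a, a + 1}) \<and>
     M = monoid_gen {a, a + 1, f} \<and>
     numerical_monoid M \<and>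
     distinct [a, a + 1, f] \<and> minimal_generators M {a, a + 1, f} \<and>
     int (mon_catenary_degree a (a + 1) f) - int (catenary_degree a (a + 1) f) \<ge> int N"
    using a frobenius_number_consecutive[OF f, symmetric] numerical_monoid_frobenius[OF f]
      minimal_generators_frobenius[OF f a]
    by blast
qed

end
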